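(* For every integer $d\ge3$, for the model $\mathcal{J}_{n,d}$ the smallest order of a supercritical tangle is $\tau_{\mathrm{fund}}=\lceil\sqrt{d-1}\rceil-1$.
   Context: $\mathcal{J}_{n,d}$ ($n$ odd): for $j=1,\dots,d$ independently, choose a uniformly random near perfect matching of $\{1,\dots,n\}$ (matching all but one element), whose edges are labelled $\sigma_j$, together with a half-loop labelled $\tau_j$ at the unmatched vertex; the union is a $d$-regular graph. A half-loop is a single directed self-loop that is its own reverse. A tangle is a connected labelled graph that occurs (via a label-preserving homomorphism injective on vertices and edges) in some graph of $\mathcal{J}_{n,d}$ for some $n$. The order of a graph is (number of undirected edges) $-$ (number of vertices), each half-loop counting as one edge. For a graph $T$, $T_{\mathrm{irr}}$ is the directed graph on the directed edges of $T$ with $e_1\to e_2$ iff $e_1$ terminates at the origin of $e_2$ and $e_2$ is not the reverse of $e_1$ (so there is no edge from a half-loop to itself); $\lambda_{\mathrm{irr}}(T)$ is the Perron–Frobenius eigenvalue of $T_{\mathrm{irr}}$. A tangle is supercritical if $\lambda_{\mathrm{irr}}\ge\sqrt{d-1}$. *)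

theory Defs
  imports
    "HOL-Probability.Probability"
    "Graph_Theory.Digraph_Component"
    "Jordan_Normal_Form.Spectral_Radius"
begin

datatype edge_label = sigma nat | tau nat

text \<open>
  A graph is a directed multigraph together with an edge reversal. An undirected edge
  is an orbit of the reversal: a half-loop is a fixed point of it, while a whole loop is a pair of
  distinct self-loops that reverse each other. Both directions of an undirected edge carry the
  label of that edge.
\<close>

record ('v, 'e, 'l) labelled_graph =
  digraph_of :: "('v, 'e) pre_digraph"
  rev_of :: "'e \<Rightarrow> 'e"
  label_of :: "'e \<Rightarrow> 'l"

definition is_labelled_graph :: "('v, 'e, 'l) labelled_graph \<Rightarrow> bool" where
  "is_labelled_graph G \<longleftrightarrow>
     fin_digraph (digraph_of G) \<and>
     (\<forall>e \<in> arcs (digraph_of G).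
        rev_of G e \<in> arcs (digraph_of G) \<and>
        rev_of G (rev_of G e) = e \<and>
        tail (digraph_of G) (rev_of G e) = head (digraph_of G) e \<and>
        label_of G (rev_of G e) = label_of G e)"

definition undirected_edges :: "('v, 'e, 'l) labelled_graph \<Rightarrow> 'e set set" where
  "undirected_edges G = (\<lambda>e. {e, rev_of G e}) ` arcs (digraph_of G)"

definition graph_order :: "('v, 'e, 'l) labelled_graph \<Rightarrow> int" where
  "graph_order G = int (card (undirected_edges G)) - int (card (verts (digraph_of G)))"

definition injective_hom ::
  "('v, 'e, 'l) labelled_graph \<Rightarrow> ('w, 'f, 'l) labelled_graph \<Rightarrow> ('v \<Rightarrow> 'w) \<Rightarrow> ('e \<Rightarrow> 'f) \<Rightarrow> bool" where
  "injective_hom T G f g \<longleftrightarrow>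
     f ` verts (digraph_of T) \<subseteq> verts (digraph_of G) \<and>
     g ` arcs (digraph_of T) \<subseteq> arcs (digraph_of G) \<and>
     inj_on f (verts (digraph_of T)) \<and>
     inj_on g (arcs (digraph_of T)) \<and>
     (\<forall>e \<in> arcs (digraph_of T).
        tail (digraph_of G) (g e) = f (tail (digraph_of T) e) \<and>
        head (digraph_of G) (g e) = f (head (digraph_of T) e) \<and>
        rev_of G (g e) = g (rev_of T e) \<and>
        label_of G (g e) = label_of T e)"

definition near_perfect_matchings :: "nat \<Rightarrow> nat set set set" where
  "near_perfect_matchings n =
     {M. (\<forall>e \<in> M. e \<subseteq> {1..n} \<and> card e = 2) \<and> disjoint M \<and> card ({1..n} - \<Union>M) = 1}"

text \<open>
  The directed edge \<open>(j, u, v)\<close> of the following graph goes from \<open>u\<close> to \<open>v\<close> and comes from the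
  \<open>j\<close>-th matching; it is the half-loop of that matching precisely when \<open>u = v\<close>.
\<close>

definition matchings_graph ::
  "nat \<Rightarrow> nat \<Rightarrow> (nat \<Rightarrow> nat set set) \<Rightarrow> (nat, nat \<times> nat \<times> nat, edge_label) labelled_graph" where
  "matchings_graph n d M = \<lparr>
     digraph_of = \<lparr>
       verts = {1..n},
       arcs = {(j, u, v). j \<in> {1..d} \<and> {u, v} \<in> M j} \<union>
              {(j, u, u) |j u. j \<in> {1..d} \<and> u \<in> {1..n} - \<Union>(M j)},
       tail = (\<lambda>(j, u, v). u),
       head = (\<lambda>(j, u, v). v)\<rparr>,
     rev_of = (\<lambda>(j, u, v). (j, v, u)),
     label_of = (\<lambda>(j, u, v). if u = v then tau j else sigma j)\<rparr>"

text \<open>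
  The model is used for odd \<open>n\<close> only: there are no near perfect matchings for even \<open>n\<close>. The second
  argument of \<^const>\<open>Pi_pmf\<close> is the irrelevant value outside \<open>{1..d}\<close>.
\<close>

definition J_model :: "nat \<Rightarrow> nat \<Rightarrow> (nat, nat \<times> nat \<times> nat, edge_label) labelled_graph pmf" where
  "J_model n d =
     map_pmf (matchings_graph n d) (Pi_pmf {1..d} {} (\<lambda>_. pmf_of_set (near_perfect_matchings n)))"

definition is_tangle :: "nat \<Rightarrow> ('v, 'e, edge_label) labelled_graph \<Rightarrow> bool" where
  "is_tangle d T \<longleftrightarrow>
     is_labelled_graph T \<and>
     Digraph_Component.connected (digraph_of T) \<and>
     (\<exists>n. odd n \<and> (\<exists>G \<in> set_pmf (J_model n d). \<exists>f g. injective_hom T G f g))"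

definition T_irr :: "('v, 'e, 'l) labelled_graph \<Rightarrow> ('e, 'e \<times> 'e) pre_digraph" where
  "T_irr T = \<lparr>
     verts = arcs (digraph_of T),
     arcs = {(e1, e2). e1 \<in> arcs (digraph_of T) \<and> e2 \<in> arcs (digraph_of T) \<and>
               head (digraph_of T) e1 = tail (digraph_of T) e2 \<and> e2 \<noteq> rev_of T e1},
     tail = fst,
     head = snd\<rparr>"

text \<open>
  The vertices are linearly ordered only to index the rows and columns; another order conjugates the
  matrix by a permutation and leaves its eigenvalues unchanged.
\<close>

definition adjacency_matrix :: "('v :: linorder, 'e) pre_digraph \<Rightarrow> complex mat" where
  "adjacency_matrix G =
     (let vs = sorted_list_of_set (verts G); n = length vs
      in mat n n (\<lambda>(i, j). of_nat (card {a \<in> arcs G. tail G a = vs ! i \<and> head G a = vs ! j})))"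

text \<open>
  The Perron--Frobenius eigenvalue of a non-negative matrix is its spectral radius.
  On the empty matrix, which has no eigenvalues, \<^const>\<open>spectral_radius\<close> is
  unspecified; the value is then taken to be 0.
\<close>

definition PF_eigenvalue :: "('v :: linorder, 'e) pre_digraph \<Rightarrow> real" where
  "PF_eigenvalue G = (if verts G = {} then 0 else spectral_radius (adjacency_matrix G))"

definition lambda_irr :: "('v, 'e :: linorder, 'l) labelled_graph \<Rightarrow> real" where
  "lambda_irr T = PF_eigenvalue (T_irr T)"

definition supercritical_tangle :: "nat \<Rightarrow> ('v, 'e :: linorder, edge_label) labelled_graph \<Rightarrow> bool" where
  "supercritical_tangle d T \<longleftrightarrow> is_tangle d T \<and> lambda_irr T \<ge> sqrt (real d - 1)"

text \<open>
  Tangles are finite, so up to isomorphism all of them have vertices and edges in \<^typ>\<open>nat\<close>.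
\<close>

definition supercritical_orders :: "nat \<Rightarrow> int set" where
  "supercritical_orders d =
     {graph_order T |T :: (nat, nat, edge_label) labelled_graph. supercritical_tangle d T}"

end

theory Submission
  imports Defs
begin

text \<open>
  Let \<open>c\<close> be the order plus 1. In a tangle every self-loop is a half-loop, and then
  \<open>\<lambda>\<^sub>i\<^sub>r\<^sub>r \<le> c\<close>: pruning leaves changes neither the order nor the non-zero spectrum, so assume minimum
  degree 2. The excess degrees \<open>deg v - 2\<close> sum to \<open>2 * c - 2\<close> minus the number of half-loops, so
  \<open>(deg v - 1) + (deg w - 1) \<le> 2 * c\<close> for distinct \<open>v\<close>, \<open>w\<close>, and the number of
  non-backtracking continuations of length 2 is at most \<open>c\<^sup>2\<close> by AM-GM; the half-loops are absorbed by
  the same estimate. Equality holds for two vertices joined by \<open>c + 1\<close> parallel edges, which occur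
  in the model as soon as \<open>c < d\<close>.
\<close>

section \<open>Arcs with a reversal and without whole loops\<close>

text \<open>Vertices enter only as endpoints of arcs, so every reversal-closed subset of
  \<open>A\<close> is again an instance.\<close>

locale involutive_digraph =
  fixes A :: "'e set" and src tgt :: "'e \<Rightarrow> 'v" and rv :: "'e \<Rightarrow> 'e"
  assumes finite_A: "finite A"
    and rv_in: "e \<in> A \<Longrightarrow> rv e \<in> A"
    and rv_rv: "e \<in> A \<Longrightarrow> rv (rv e) = e"
    and src_rv: "e \<in> A \<Longrightarrow> src (rv e) = tgt e"
    and loop: "e \<in> A \<Longrightarrow> src e = tgt e \<Longrightarrow> rv e = e"
begin

definition edges :: "'e set set" where
  "edges = (\<lambda>e. {e, rv e}) ` A"

definition succs :: "'e \<Rightarrow> 'e set" where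
  "succs e = {f \<in> A. src f = tgt e \<and> f \<noteq> rv e}"

definition out :: "'v \<Rightarrow> 'e set" where
  "out v = {e \<in> A. src e = v}"

definition half_loops :: "'e set" where
  "half_loops = {e \<in> A. rv e = e}"

text \<open>A right eigenvector of the non-backtracking matrix, indexed by arcs. Values outside
  \<open>A\<close> are arbitrary, so the same \<open>y\<close> can be tested on subsets of
  \<open>A\<close>.\<close>

definition eigenfunction :: "complex \<Rightarrow> ('e \<Rightarrow> complex) \<Rightarrow> bool" where
  "eigenfunction l y \<longleftrightarrow> (\<forall>e \<in> A. l * y e = (\<Sum>f \<in> succs e. y f)) \<and> (\<exists>e \<in> A. y e \<noteq> 0)"

lemma tgt_rv: "e \<in> A \<Longrightarrow> tgt (rv e) = src e"
  using src_rv rv_in rv_rv by metis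

lemma finite_succs: "finite (succs e)"
  and finite_half_loops: "finite half_loops"
  using finite_A by (auto simp: succs_def half_loops_def)

lemma succs_eq: "succs e = out (tgt e) - {rv e}"
  by (auto simp: succs_def out_def)

lemma card_succs: "e \<in> A \<Longrightarrow> card (succs e) = card (out (tgt e)) - 1"
  unfolding succs_eq by (rule card_Diff_singleton) (auto simp: out_def rv_in src_rv)

text \<open>Group the arcs by edge: an ordinary edge contains two arcs, a half-loop only one, and
  \<open>half_loops\<close> supplies the missing unit.\<close>

lemma two_card_edges: "2 * card edges = card A + card half_loops"
proof -
  let ?b = "\<lambda>e. {e, rv e}"
  have A: "card A = (\<Sum>p\<in>edges. card {e \<in> A. ?b e = p})"
    unfolding edges_def card_eq_sum by (rule sum.image_gen[OF finite_A])
  have "card half_loops = (\<Sum>p\<in>edges. card {e \<in> half_loops. ?b e = p})"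
    unfolding card_eq_sum
    by (rule sum.group[symmetric]) (auto simp: edges_def half_loops_def finite_A)
  then have "card A + card half_loops
      = (\<Sum>p\<in>edges. card {e \<in> A. ?b e = p} + card {e \<in> half_loops. ?b e = p})"
    using A by (simp add: sum.distrib)
  also have "\<dots> = (\<Sum>p\<in>edges. 2)"
  proof (rule sum.cong[OF refl])
    fix p assume "p \<in> edges"
    then obtain e where e: "e \<in> A" and p: "p = {e, rv e}" by (auto simp: edges_def)
    have 1: "{f \<in> A. ?b f = p} = {e, rv e}"
      using e rv_in rv_rv unfolding p by (auto simp: doubleton_eq_iff)
    have 2: "{f \<in> half_loops. ?b f = p} = (if rv e = e then {e} else {})"
      using e rv_in rv_rv unfolding p half_loops_def by (auto simp: doubleton_eq_iff)
    show "card {e \<in> A. ?b e = p} + card {e \<in> half_loops. ?b e = p} = 2"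
      unfolding 1 2 by auto
  qed
  finally show ?thesis by simp
qed

section \<open>Pruning to minimum degree 2\<close>

text \<open>
  Deleting a vertex of degree 1 deletes an arc \<open>f\<close> and its reverse; the latter has no successor, so an
  eigenfunction for a non-zero eigenvalue vanishes on it. Hence a smallest reversal-closed subset on
  which the function remains an eigenfunction has minimum degree at least 2.
\<close>

lemma exists_core:
  assumes y: "eigenfunction l y" and l: "l \<noteq> 0"
  obtains C where "C \<subseteq> A" "involutive_digraph C src tgt rv"
    "involutive_digraph.eigenfunction C src tgt rv l y"
    "\<And>e. e \<in> C \<Longrightarrow> 2 \<le> card {f \<in> C. src f = src e}"
proof -
  let ?S = "\<lambda>C e. {f \<in> C. src f = tgt e \<and> f \<noteq> rv e}"
  define P where "P C \<longleftrightarrow> C \<subseteq> A \<and> (\<forall>e\<in>C. rv e \<in> C) \<and> (\<forall>e\<in>C. l * y e = sum y (?S C e))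
    \<and> (\<exists>e\<in>C. y e \<noteq> 0)" for C
  have "P A" using y rv_in unfolding P_def eigenfunction_def succs_def by auto
  then obtain C where PC: "P C" and least: "\<And>D. P D \<Longrightarrow> card C \<le> card D"
    using ex_has_least_nat[of P A card] by blast
  have CA: "C \<subseteq> A" and Crv: "\<And>e. e \<in> C \<Longrightarrow> rv e \<in> C"
    and Cy: "\<And>e. e \<in> C \<Longrightarrow> l * y e = sum y (?S C e)" and Cne: "\<exists>e\<in>C. y e \<noteq> 0"
    using PC unfolding P_def by simp_all
  have finC: "finite C" using CA finite_A finite_subset by blast
  have inv: "involutive_digraph C src tgt rv"
    by unfold_locales (use CA Crv finC rv_rv src_rv loop in auto)
  have deg: "2 \<le> card {f \<in> C. src f = src e}" if e: "e \<in> C" for e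
  proof (rule ccontr)
    assume neg: "\<not> 2 \<le> card {f \<in> C. src f = src e}"
    have "card {f \<in> C. src f = src e} \<le> Suc 0" using neg by simp
    then have only: "f = e" if "f \<in> C" "src f = src e" for f
      using that e finC by (subst (asm) card_le_Suc0_iff_eq) auto
    have eA: "e \<in> A" using e CA by blast
    \<comment> \<open>As \<open>e\<close> is the only arc of \<open>C\<close> leaving its source, a
      walk cannot continue after \<open>rv e\<close> without backtracking.\<close>
    have "?S C (rv e) = {}"
    proof (rule equals0I)
      fix f assume "f \<in> ?S C (rv e)"
      then have "f \<in> C" "src f = src e" "f \<noteq> e" using eA by (simp_all add: rv_rv tgt_rv)
      then show False using only by blast
    qed
    then have "l * y (rv e) = 0" using Cy[OF Crv[OF e]] by (simp only: sum.empty)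
    then have y0: "y (rv e) = 0" using l by simp
    let ?D = "C - {e, rv e}"
    \<comment> \<open>The arc \<open>rv e\<close> contributes 0. The arc \<open>e\<close> can start
      where \<open>a\<close> ends only if \<open>rv a\<close> also leaves \<open>src e\<close>,
      which forces \<open>rv a = e\<close> and so \<open>a = rv e\<close>.\<close>
    have sums: "sum y (?S C a) = sum y (?S ?D a)" if a: "a \<in> C" "a \<noteq> rv e" for a
    proof (rule sum.mono_neutral_right)
      show "finite (?S C a)" using finC by auto
      show "?S ?D a \<subseteq> ?S C a" by auto
      show "\<forall>i\<in>?S C a - ?S ?D a. y i = 0"
      proof
        fix i assume i: "i \<in> ?S C a - ?S ?D a"
        have "i \<noteq> e"
        proof
          assume ie: "i = e"
          then have "src e = tgt a" using i by simp
          moreover have "src (rv a) = tgt a" using a CA by (intro src_rv) blast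
          ultimately have "src (rv a) = src e" by simp
          then have "rv a = e" using only Crv a by blast
          moreover have "rv (rv a) = a" using a CA by (intro rv_rv) blast
          ultimately show False using a by simp
        qed
        then show "y i = 0" using i y0 by auto
      qed
    qed
    \<comment> \<open>Otherwise \<open>y e\<close> would be the only non-zero value on
      \<open>C\<close>, yet \<open>l * y e\<close> is a sum of values on \<open>?D\<close>.\<close>
    have "\<exists>a\<in>?D. y a \<noteq> 0"
    proof (rule ccontr)
      assume "\<not> ?thesis"
      then have z: "\<And>a. a \<in> ?D \<Longrightarrow> y a = 0" by blast
      then have ye: "y e \<noteq> 0" using Cne y0 by blast
      then have "e \<noteq> rv e" using y0 by auto
      then have "l * y e = sum y (?S ?D e)" using sums[OF e] Cy[OF e] by simp
      also have "\<dots> = 0" using z by (intro sum.neutral) auto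
      finally show False using ye l by simp
    qed
    moreover have "rv a \<in> ?D" if "a \<in> ?D" for a
    proof -
      have "a \<in> A" "a \<in> C" using that CA by auto
      then have "rv a \<noteq> e" "rv a \<noteq> rv e" using that rv_rv[OF eA] rv_rv[of a] by auto
      then show ?thesis using Crv[OF \<open>a \<in> C\<close>] by blast
    qed
    moreover have "l * y a = sum y (?S ?D a)" if "a \<in> ?D" for a
      using that sums[of a] Cy[of a] by simp
    ultimately have "P ?D" using CA unfolding P_def by blast
    from least[OF this] have "card C \<le> card ?D" .
    moreover have "card ?D < card C"
      by (rule psubset_card_mono[OF finC]) (use e in blast)
    ultimately show False by simp
  qed
  have "involutive_digraph.eigenfunction C src tgt rv l y"
    unfolding involutive_digraph.eigenfunction_def[OF inv] involutive_digraph.succs_def[OF inv]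
    using Cy Cne by blast
  then show ?thesis using that CA inv deg by blast
qed

section \<open>The bound for minimum degree 2\<close>

text \<open>
  The bound is on the row sums of the square of the non-backtracking matrix: a single row sum can be
  as large as \<open>2 * c - 1\<close>, where \<open>c = card edges - card (src ` A) + 1\<close>.
\<close>

lemma eigenvalue_bound_min_degree_2:
  assumes y: "eigenfunction l y" and deg: "\<And>e. e \<in> A \<Longrightarrow> 2 \<le> card (out (src e))"
  shows "cmod l \<le> real (card edges) - real (card (src ` A)) + 1"
proof -
  define c where "c = real (card edges) - real (card (src ` A)) + 1"
  \<comment> \<open>The excess degree. A half-loop counts once in \<open>out v\<close>, hence the
    subtraction of half-loops in \<open>sumx\<close>.\<close>
  define x where "x v = real (card (out v)) - 2" for v
  have finV: "finite (src ` A)" using finite_A by simp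
  have x0: "x v \<ge> 0" if "v \<in> src ` A" for v
    using that deg unfolding x_def by force
  have tgtV: "tgt e \<in> src ` A" if "e \<in> A" for e
    using rv_in[OF that] src_rv[OF that] by (metis imageI)
  have "card A = (\<Sum>v\<in>src ` A. card (out v))"
    unfolding card_eq_sum out_def by (rule sum.image_gen[OF finite_A])
  then have "real (card A) = (\<Sum>v\<in>src ` A. real (card (out v)))" by simp
  moreover have "2 * real (card edges) = real (card A) + real (card half_loops)"
    using arg_cong[OF two_card_edges, of real] by simp
  ultimately have sumx: "(\<Sum>v\<in>src ` A. x v) = 2 * c - 2 - real (card half_loops)"
    unfolding x_def c_def by (simp add: sum_subtractf)
  have A0: "A \<noteq> {}" using y unfolding eigenfunction_def by blast
  then have "Max ((\<lambda>e. cmod (y e)) ` A) \<in> (\<lambda>e. cmod (y e)) ` A"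
    using finite_A by (intro Max_in) auto
  then obtain e where e: "e \<in> A" and "Max ((\<lambda>e. cmod (y e)) ` A) = cmod (y e)" by auto
  then have max: "cmod (y a) \<le> cmod (y e)" if "a \<in> A" for a
    using that finite_A by (metis (mono_tags, lifting) Max_ge finite_imageI imageI)
  have ye: "cmod (y e) > 0"
    using y max unfolding eigenfunction_def by (metis norm_le_zero_iff not_le order_trans)
  define v where "v = tgt e"
  have vV: "v \<in> src ` A" unfolding v_def by (rule tgtV[OF e])
  define a where "a = real (card (succs e))"
  \<comment> \<open>\<open>H\<close> consists of half-loops at \<open>v\<close>, each of which again
    has \<open>a\<close> successors. The other successors of \<open>e\<close> end elsewhere, where
    \<open>b\<close> will bound the number of continuations.\<close>
  define H where "H = {f \<in> succs e. tgt f = v}"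
  define h where "h = real (card H)"
  define b where "b = 2 * c - h - a"
  have succs_real: "real (card (succs f)) = x (tgt f) + 1" if "f \<in> A" for f
  proof -
    have "2 \<le> card (out (tgt f))"
      using deg[OF rv_in[OF that]] src_rv[OF that] by simp
    then show ?thesis using card_succs[OF that] unfolding x_def by simp
  qed
  have a: "a = x v + 1" unfolding a_def v_def by (rule succs_real[OF e])
  have Hsub: "H \<subseteq> half_loops" "H \<subseteq> succs e"
    unfolding H_def half_loops_def succs_def v_def using loop by auto
  then have h: "h \<le> real (card half_loops)" and ha: "h \<le> a"
    unfolding h_def a_def using finite_half_loops finite_succs by (auto intro: card_mono)
  \<comment> \<open>Together \<open>v\<close> and \<open>w\<close> have excess at most
    \<open>2 * c - 2 - h\<close>, and \<open>x v = a - 1\<close>; this dictates the value of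
    \<open>b\<close>.\<close>
  have bw: "x w + 1 \<le> b" if w: "w \<in> src ` A" "w \<noteq> v" for w
  proof -
    have "(\<Sum>u\<in>{v, w}. x u) \<le> (\<Sum>u\<in>src ` A. x u)"
      by (rule sum_mono2[OF finV]) (use w vV x0 in auto)
    then show ?thesis using w sumx a h unfolding b_def by simp
  qed
  \<comment> \<open>The excess at \<open>v\<close> alone gives \<open>b \<ge> 1\<close>, even if
    \<open>v\<close> is the only vertex.\<close>
  have "x v \<le> (\<Sum>u\<in>src ` A. x u)"
    by (rule member_le_sum[OF vV]) (use x0 finV in auto)
  then have b1: "b \<ge> 1" and c1: "c \<ge> 1"
    using sumx a h x0[OF vV] unfolding b_def by auto
  have outer: "cmod l * cmod (y f) \<le> real (card (succs f)) * cmod (y e)" if f: "f \<in> A" for f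
  proof -
    have "cmod l * cmod (y f) = cmod (\<Sum>g\<in>succs f. y g)"
      using y f unfolding eigenfunction_def by (metis norm_mult)
    also have "\<dots> \<le> (\<Sum>g\<in>succs f. cmod (y e))"
      by (rule sum_norm_le) (auto simp: succs_def max)
    finally show ?thesis by simp
  qed
  have "(\<Sum>f\<in>succs e. real (card (succs f)))
      = (\<Sum>f\<in>H. real (card (succs f))) + (\<Sum>f\<in>succs e - H. real (card (succs f)))"
    using sum.subset_diff[OF Hsub(2) finite_succs] by (simp add: add.commute)
  also have "\<dots> \<le> (\<Sum>f\<in>H. a) + (\<Sum>f\<in>succs e - H. b)"
  proof (rule add_mono; rule sum_mono)
    fix f assume "f \<in> H"
    then show "real (card (succs f)) \<le> a"
      using succs_real[of f] a unfolding H_def succs_def by simp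
  next
    fix f assume "f \<in> succs e - H"
    then have "f \<in> A" "tgt f \<noteq> v" unfolding H_def succs_def by auto
    then show "real (card (succs f)) \<le> b"
      using succs_real[of f] bw[of "tgt f"] tgtV[of f] by simp
  qed
  also have "\<dots> = h * a + (a - h) * b"
    using Hsub(2) finite_succs ha finite_subset[OF Hsub(2) finite_succs]
    by (simp add: h_def a_def card_Diff_subset of_nat_diff)
  also have "\<dots> \<le> c\<^sup>2"
  proof -
    \<comment> \<open>Here \<open>2 * c = a + b + h\<close>: the gap is the AM-GM square plus a
      non-negative term due to the half-loops.\<close>
    have "4 * (c\<^sup>2 - (h * a + (a - h) * b)) = (a - b - h)\<^sup>2 + 4 * (b * h)"
      unfolding b_def power2_eq_square by (simp add: algebra_simps)
    moreover have "b * h \<ge> 0" using b1 unfolding h_def by simp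
    ultimately have "4 * (c\<^sup>2 - (h * a + (a - h) * b)) \<ge> 0"
      using zero_le_power2[of "a - b - h"] by linarith
    then show ?thesis by simp
  qed
  finally have rows: "(\<Sum>f\<in>succs e. real (card (succs f))) \<le> c\<^sup>2" .
  \<comment> \<open>The eigenvalue equation is applied twice, at the arc \<open>e\<close> where
    \<open>y\<close> has maximal modulus and, through \<open>outer\<close>, at its
    successors.\<close>
  have "(cmod l)\<^sup>2 * cmod (y e) = cmod l * cmod (\<Sum>f\<in>succs e. y f)"
    using y e unfolding eigenfunction_def by (metis norm_mult mult.assoc power2_eq_square)
  also have "\<dots> \<le> cmod l * (\<Sum>f\<in>succs e. cmod (y f))"
    by (intro mult_left_mono norm_sum) simp
  also have "\<dots> \<le> (\<Sum>f\<in>succs e. real (card (succs f)) * cmod (y e))"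
    unfolding sum_distrib_left by (rule sum_mono, rule outer) (simp add: succs_def)
  also have "\<dots> \<le> c\<^sup>2 * cmod (y e)"
    unfolding sum_distrib_right[symmetric] using rows by (rule mult_right_mono) simp
  finally have "(cmod l)\<^sup>2 \<le> c\<^sup>2" using ye by simp
  then show ?thesis using c1 unfolding c_def[symmetric] by (simp add: power2_le_iff_abs_le)
qed

section \<open>From the core to the whole graph\<close>

text \<open>Grow \<open>W\<close> to \<open>V\<close> one vertex at a time along crossing arcs, as
  for a spanning tree; each new vertex uses up an edge that did not lie inside the previous
  set.\<close>

lemma card_edges_leaving:
  assumes "finite V" "src ` A \<subseteq> V" "W \<subseteq> V" "W \<noteq> {}"
    and conn: "\<And>W. W \<subseteq> V \<Longrightarrow> W \<noteq> {} \<Longrightarrow> W \<noteq> V \<Longrightarrow> \<exists>e\<in>A. src e \<in> W \<and> tgt e \<notin> W"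
  shows "card (V - W) \<le> card ((\<lambda>e. {e, rv e}) ` {e \<in> A. \<not> (src e \<in> W \<and> tgt e \<in> W)})"
  using assms(3,4)
proof (induction "card (V - W)" arbitrary: W)
  case 0
  then show ?case by simp
next
  case (Suc n)
  then have "W \<noteq> V" by auto
  then obtain e where e: "e \<in> A" "src e \<in> W" "tgt e \<notin> W" using conn Suc.prems by blast
  have tV: "tgt e \<in> V" using rv_in[OF e(1)] src_rv[OF e(1)] assms(2) by force
  let ?E = "\<lambda>W. (\<lambda>e. {e, rv e}) ` {e \<in> A. \<not> (src e \<in> W \<and> tgt e \<in> W)}"
  let ?W = "insert (tgt e) W"
  have card: "card (V - W) = Suc (card (V - ?W))"
    using card_Suc_Diff1[of "V - W" "tgt e"] tV e \<open>finite V\<close>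
    by (simp add: Diff_insert[symmetric])
  then have "n = card (V - ?W)" using Suc.hyps(2) by simp
  from Suc.hyps(1)[OF this] have IH: "card (V - ?W) \<le> card (?E ?W)"
    using tV Suc.prems by blast
  have "{e, rv e} \<notin> ?E ?W"
  proof
    assume "{e, rv e} \<in> ?E ?W"
    then obtain a where "{e, rv e} = {a, rv a}" and a: "\<not> (src a \<in> ?W \<and> tgt a \<in> ?W)"
      by (elim imageE) simp
    then have "a \<in> {e, rv e}" by blast
    then show False using a e by (auto simp: src_rv tgt_rv)
  qed
  moreover have "insert {e, rv e} (?E ?W) \<subseteq> ?E W"
    using e by auto
  moreover have "finite (?E W)" using finite_A by simp
  ultimately have "Suc (card (?E ?W)) \<le> card (?E W)"
    using card_mono[of "?E W" "insert {e, rv e} (?E ?W)"] finite_A by simp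
  then show ?case using IH card by simp
qed

text \<open>The core satisfies the bound with its own edges and vertices. Outside it there are at
  least as many edges as vertices, so the right-hand side can only grow.\<close>

theorem eigenvalue_bound:
  assumes y: "eigenfunction l y" "l \<noteq> 0"
    and V: "finite V" "src ` A \<subseteq> V"
    and conn: "\<And>W. W \<subseteq> V \<Longrightarrow> W \<noteq> {} \<Longrightarrow> W \<noteq> V \<Longrightarrow> \<exists>e\<in>A. src e \<in> W \<and> tgt e \<notin> W"
  shows "cmod l \<le> real (card edges) - real (card V) + 1"
proof -
  obtain C where CA: "C \<subseteq> A" and C: "involutive_digraph C src tgt rv"
    and Cy: "involutive_digraph.eigenfunction C src tgt rv l y"
    and deg: "\<And>e. e \<in> C \<Longrightarrow> 2 \<le> card {f \<in> C. src f = src e}"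
    using exists_core[OF y] by blast
  interpret C: involutive_digraph C src tgt rv by (rule C)
  let ?W = "src ` C"
  let ?E = "(\<lambda>e. {e, rv e}) ` {e \<in> A. \<not> (src e \<in> ?W \<and> tgt e \<in> ?W)}"
  have bound: "cmod l \<le> real (card C.edges) - real (card ?W) + 1"
    by (rule C.eigenvalue_bound_min_degree_2[OF Cy]) (simp add: C.out_def deg)
  have "C \<noteq> {}" using Cy unfolding C.eigenfunction_def by blast
  have WV: "?W \<subseteq> V" using CA V by blast
  have tgtC: "tgt e \<in> ?W" if "e \<in> C" for e
    using C.rv_in[OF that] C.src_rv[OF that] by (metis imageI)
  have disj: "C.edges \<inter> ?E = {}"
  proof (rule ccontr)
    assume "C.edges \<inter> ?E \<noteq> {}"
    then obtain p where "p \<in> C.edges" "p \<in> ?E" by (auto simp only: ex_in_conv[symmetric] Int_iff)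
    then obtain a e where a: "a \<in> C" "p = {a, rv a}"
      and e: "p = {e, rv e}" "\<not> (src e \<in> ?W \<and> tgt e \<in> ?W)"
      unfolding C.edges_def by (elim imageE) simp
    have "e \<in> {a, rv a}" using a(2) e(1) by blast
    then have "e \<in> C" using a(1) C.rv_in by blast
    then show False using e(2) tgtC by simp
  qed
  have "card (V - ?W) \<le> card ?E"
    by (rule card_edges_leaving[OF V WV _ conn]) (use \<open>C \<noteq> {}\<close> in simp_all)
  moreover have "card C.edges + card ?E \<le> card edges"
  proof -
    have "finite edges" using finite_A unfolding edges_def by simp
    moreover have "C.edges \<union> ?E \<subseteq> edges"
      unfolding edges_def C.edges_def by (intro Un_least image_mono CA Collect_subset)
    ultimately have "card (C.edges \<union> ?E) \<le> card edges" "finite C.edges" "finite ?E"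
      using finite_subset[of "C.edges \<union> ?E" edges] by (simp_all add: card_mono)
    then show ?thesis using disj by (simp add: card_Un_disjoint)
  qed
  moreover have "card (V - ?W) = card V - card ?W" "card ?W \<le> card V"
    using WV V(1) by (simp_all add: card_Diff_subset finite_subset card_mono)
  ultimately show ?thesis using bound by linarith
qed

end

section \<open>Eigenvectors as functions on vertices and arcs\<close>

lemma adjacency_matrix_mult_vec:
  fixes G :: "('v :: linorder, 'e) pre_digraph"
  assumes fin: "finite (verts G)" and i: "i < card (verts G)"
  defines "vs \<equiv> sorted_list_of_set (verts G)"
  shows "(adjacency_matrix G *\<^sub>v vec (card (verts G)) (\<lambda>i. y (vs ! i))) $ i
    = (\<Sum>w\<in>verts G. of_nat (card {a \<in> arcs G. tail G a = vs ! i \<and> head G a = w}) * y w)"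
proof -
  let ?c = "\<lambda>w. of_nat (card {a \<in> arcs G. tail G a = vs ! i \<and> head G a = w}) * y w"
  have len: "length vs = card (verts G)" unfolding vs_def using fin by simp
  have "bij_betw ((!) vs) {0..<card (verts G)} (verts G)"
    by (rule bij_betw_nth) (use fin in \<open>auto simp: vs_def\<close>)
  then have "(\<Sum>j = 0..<card (verts G). ?c (vs ! j)) = (\<Sum>w\<in>verts G. ?c w)"
    by (rule sum.reindex_bij_betw)
  then show ?thesis
    using i unfolding adjacency_matrix_def Let_def vs_def[symmetric] len
    by (simp add: scalar_prod_def)
qed

text \<open>The sorted list is a bijection from indices to vertices; transporting vectors along it
  removes the auxiliary order.\<close>

lemma eigenvalue_adjacency_matrix_iff:
  fixes G :: "('v :: linorder, 'e) pre_digraph"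
  assumes fin: "finite (verts G)"
  shows "eigenvalue (adjacency_matrix G) k \<longleftrightarrow>
    (\<exists>y. (\<exists>v\<in>verts G. y v \<noteq> 0) \<and> (\<forall>v\<in>verts G.
      k * y v = (\<Sum>w\<in>verts G. of_nat (card {a \<in> arcs G. tail G a = v \<and> head G a = w}) * y w)))"
    (is "_ \<longleftrightarrow> (\<exists>y. ?P y)")
proof -
  define vs where "vs = sorted_list_of_set (verts G)"
  define n where "n = card (verts G)"
  have bij: "bij_betw ((!) vs) {..<n} (verts G)"
    by (rule bij_betw_nth) (use fin in \<open>auto simp: vs_def n_def\<close>)
  have all: "(\<forall>v\<in>verts G. Q v) \<longleftrightarrow> (\<forall>i<n. Q (vs ! i))" for Q
    by (auto simp: bij_betw_imp_surj_on[OF bij, symmetric])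
  have dim: "dim_row (adjacency_matrix G) = n"
    unfolding adjacency_matrix_def Let_def n_def using fin by simp
  have ev: "eigenvector (adjacency_matrix G) (vec n (\<lambda>i. y (vs ! i))) k \<longleftrightarrow> ?P y" for y
  proof -
    have "vec n (\<lambda>i. y (vs ! i)) \<noteq> 0\<^sub>v n \<longleftrightarrow> (\<exists>v\<in>verts G. y v \<noteq> 0)"
      using all[of "\<lambda>v. y v = 0"] by (auto simp: vec_eq_iff)
    moreover have "adjacency_matrix G *\<^sub>v vec n (\<lambda>i. y (vs ! i)) = k \<cdot>\<^sub>v vec n (\<lambda>i. y (vs ! i))
      \<longleftrightarrow> (\<forall>v\<in>verts G. k * y v
        = (\<Sum>w\<in>verts G. of_nat (card {a \<in> arcs G. tail G a = v \<and> head G a = w}) * y w))"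
      unfolding all vec_eq_iff using adjacency_matrix_mult_vec[OF fin] dim
      by (auto simp: vs_def n_def simp del: index_mult_mat_vec)
    ultimately show ?thesis unfolding eigenvector_def dim by simp
  qed
  show ?thesis
  proof
    assume "eigenvalue (adjacency_matrix G) k"
    then obtain w where w: "eigenvector (adjacency_matrix G) w k" unfolding eigenvalue_def by blast
    then have wn: "w \<in> carrier_vec n" unfolding eigenvector_def dim by blast
    define y where "y v = w $ inv_into {..<n} ((!) vs) v" for v
    have "w = vec n (\<lambda>i. y (vs ! i))"
      using wn inv_into_f_f[OF bij_betw_imp_inj_on[OF bij]] by (auto simp: y_def vec_eq_iff)
    then have "?P y" using w ev[of y] by simp
    then show "\<exists>y. ?P y" by (rule exI[of ?P])
  next
    assume "\<exists>y. ?P y"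
    then obtain y where "?P y" by (rule exE)
    then have "eigenvector (adjacency_matrix G) (vec n (\<lambda>i. y (vs ! i))) k" by (rule ev[THEN iffD2])
    then show "eigenvalue (adjacency_matrix G) k" unfolding eigenvalue_def by (rule exI)
  qed
qed

lemma card_arcs_T_irr:
  assumes "e \<in> arcs (digraph_of T)" "f \<in> arcs (digraph_of T)"
  shows "card {a \<in> arcs (T_irr T). tail (T_irr T) a = e \<and> head (T_irr T) a = f} =
    (if tail (digraph_of T) f = head (digraph_of T) e \<and> f \<noteq> rev_of T e then 1 else 0)"
proof -
  have "{a \<in> arcs (T_irr T). tail (T_irr T) a = e \<and> head (T_irr T) a = f} =
    (if tail (digraph_of T) f = head (digraph_of T) e \<and> f \<noteq> rev_of T e then {(e, f)} else {})"
    using assms by (auto simp: T_irr_def)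
  then show ?thesis by simp
qed

text \<open>\<open>T_irr\<close> has at most one arc between two given vertices, so the matrix
  entries are 0 or 1 and the weighted sum becomes the one in \<open>eigenfunction\<close>.\<close>

lemma eigenvalue_T_irr_iff:
  fixes T :: "('v, 'e :: linorder, 'l) labelled_graph"
  assumes "finite (arcs (digraph_of T))"
  shows "eigenvalue (adjacency_matrix (T_irr T)) k \<longleftrightarrow>
    (\<exists>y. (\<exists>e\<in>arcs (digraph_of T). y e \<noteq> 0) \<and> (\<forall>e\<in>arcs (digraph_of T).
      k * y e = (\<Sum>f | f \<in> arcs (digraph_of T) \<and> tail (digraph_of T) f = head (digraph_of T) e
        \<and> f \<noteq> rev_of T e. y f)))"
proof -
  have verts: "verts (T_irr T) = arcs (digraph_of T)" by (simp add: T_irr_def)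
  have "(\<Sum>f\<in>arcs (digraph_of T).
      of_nat (card {a \<in> arcs (T_irr T). tail (T_irr T) a = e \<and> head (T_irr T) a = f}) * y f)
    = (\<Sum>f | f \<in> arcs (digraph_of T) \<and> tail (digraph_of T) f = head (digraph_of T) e
        \<and> f \<noteq> rev_of T e. y f)" if e: "e \<in> arcs (digraph_of T)" for e and y :: "'e \<Rightarrow> complex"
  proof -
    let ?Q = "\<lambda>f. tail (digraph_of T) f = head (digraph_of T) e \<and> f \<noteq> rev_of T e"
    have "(\<Sum>f\<in>arcs (digraph_of T).
      of_nat (card {a \<in> arcs (T_irr T). tail (T_irr T) a = e \<and> head (T_irr T) a = f}) * y f)
      = (\<Sum>f\<in>arcs (digraph_of T). if ?Q f then y f else 0)"
      by (rule sum.cong) (auto simp: card_arcs_T_irr[OF e])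
    also have "\<dots> = (\<Sum>f | f \<in> arcs (digraph_of T) \<and> ?Q f. y f)"
      by (rule sum.inter_filter[OF assms, symmetric])
    finally show ?thesis .
  qed
  then show ?thesis
    using eigenvalue_adjacency_matrix_iff[of "T_irr T" k] assms unfolding verts
    by (simp cong: ball_cong)
qed

text \<open>With arcs present the matrix is non-empty and its spectral radius is attained.
  Attainment serves the upper bound, maximality the lower bound for dipoles.\<close>

lemma lambda_irr_eigenvalue:
  fixes T :: "('v, 'e :: linorder, 'l) labelled_graph"
  assumes "finite (arcs (digraph_of T))" "arcs (digraph_of T) \<noteq> {}"
  obtains k where "eigenvalue (adjacency_matrix (T_irr T)) k" "lambda_irr T = cmod k"
    and "\<And>l. eigenvalue (adjacency_matrix (T_irr T)) l \<Longrightarrow> cmod l \<le> lambda_irr T"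
proof -
  let ?A = "adjacency_matrix (T_irr T)" and ?n = "card (arcs (digraph_of T))"
  have verts: "verts (T_irr T) = arcs (digraph_of T)" by (simp add: T_irr_def)
  have A: "?A \<in> carrier_mat ?n ?n"
    unfolding adjacency_matrix_def Let_def verts using assms by auto
  have n: "?n > 0" using assms by (simp add: card_gt_0_iff)
  have lam: "lambda_irr T = spectral_radius ?A"
    unfolding lambda_irr_def PF_eigenvalue_def verts using assms by simp
  obtain k where "eigenvalue ?A k" "lambda_irr T = cmod k"
    using spectral_radius_mem_max(1)[OF A n] unfolding lam spectrum_def by auto
  moreover have "cmod l \<le> lambda_irr T" if "eigenvalue ?A l" for l
    using that spectral_radius_mem_max(2)[OF A n, of "cmod l"] unfolding lam spectrum_def by auto
  ultimately show ?thesis using that by blast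
qed

section \<open>The upper bound for tangles\<close>

text \<open>If no arc crossed, everything reachable from \<open>W\<close> in the symmetrized digraph
  would stay in \<open>W\<close>. Symmetrizing forgets directions, hence the two cases.\<close>

lemma connected_crossing_arc:
  assumes "Digraph_Component.connected G" "W \<subseteq> verts G" "W \<noteq> {}" "W \<noteq> verts G"
  obtains e where "e \<in> arcs G"
    "(tail G e \<in> W \<and> head G e \<notin> W) \<or> (head G e \<in> W \<and> tail G e \<notin> W)"
proof -
  obtain u v where uv: "u \<in> W" "v \<in> verts G" "v \<notin> W" using assms by blast
  have "(u, v) \<in> rtrancl_on (verts G) (parcs (mk_symmetric G))"
    using assms(1,2) uv
    unfolding Digraph_Component.connected_def strongly_connected_def reachable_def by auto
  then have "v \<in> W" if no: "\<not> (\<exists>e\<in>arcs G.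
      (tail G e \<in> W \<and> head G e \<notin> W) \<or> (head G e \<in> W \<and> tail G e \<notin> W))"
  proof (induction rule: rtrancl_on_induct)
    case base
    then show ?case using uv by simp
  next
    case (step y z)
    then show ?case using no unfolding parcs_mk_symmetric by auto
  qed
  then show ?thesis using that uv by blast
qed

theorem lambda_irr_le_order:
  fixes T :: "('v, 'e :: linorder, 'l) labelled_graph"
  assumes T: "is_labelled_graph T" and conn: "Digraph_Component.connected (digraph_of T)"
    and no_whole_loop: "\<And>e. e \<in> arcs (digraph_of T) \<Longrightarrow>
      tail (digraph_of T) e = head (digraph_of T) e \<Longrightarrow> rev_of T e = e"
    and pos: "lambda_irr T > 0"
  shows "lambda_irr T \<le> real_of_int (graph_order T) + 1"
proof -
  let ?D = "digraph_of T"
  interpret fin_digraph ?D using T unfolding is_labelled_graph_def by blast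
  interpret I: involutive_digraph "arcs ?D" "tail ?D" "head ?D" "rev_of T"
    by unfold_locales (use T no_whole_loop in \<open>auto simp: is_labelled_graph_def\<close>)
  \<comment> \<open>Without arcs \<open>PF_eigenvalue\<close> takes its default 0, which
    \<open>pos\<close> excludes.\<close>
  have ne: "arcs ?D \<noteq> {}"
    using pos unfolding lambda_irr_def PF_eigenvalue_def T_irr_def by (auto split: if_splits)
  obtain k where k: "eigenvalue (adjacency_matrix (T_irr T)) k" "lambda_irr T = cmod k"
    using lambda_irr_eigenvalue[OF finite_arcs ne] by blast
  then obtain y where "I.eigenfunction k y"
    unfolding I.eigenfunction_def I.succs_def using eigenvalue_T_irr_iff[OF finite_arcs] by blast
  moreover have "k \<noteq> 0" using k pos by auto
  moreover have "\<exists>e\<in>arcs ?D. tail ?D e \<in> W \<and> head ?D e \<notin> W"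
    if W: "W \<subseteq> verts ?D" "W \<noteq> {}" "W \<noteq> verts ?D" for W
    using connected_crossing_arc[OF conn W] I.rv_in I.src_rv I.tgt_rv by metis
  ultimately have "cmod k \<le> real (card I.edges) - real (card (verts ?D)) + 1"
    by (intro I.eigenvalue_bound) auto
  then show ?thesis
    unfolding k graph_order_def undirected_edges_def I.edges_def by simp
qed

text \<open>A self-loop of the model has the form \<open>(j, u, u)\<close>, which reversal fixes;
  injectivity on arcs pulls this back to \<open>T\<close>.\<close>

lemma tangle_no_whole_loop:
  assumes "is_tangle d T" "e \<in> arcs (digraph_of T)"
    "tail (digraph_of T) e = head (digraph_of T) e"
  shows "rev_of T e = e"
proof -
  obtain n G f g where G: "G \<in> set_pmf (J_model n d)" and hom: "injective_hom T G f g"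
    using assms(1) unfolding is_tangle_def by blast
  obtain M where M: "G = matchings_graph n d M" using G unfolding J_model_def by auto
  have rev: "rev_of T e \<in> arcs (digraph_of T)"
    using assms unfolding is_tangle_def is_labelled_graph_def by blast
  have "tail (digraph_of G) (g e) = head (digraph_of G) (g e)"
    using hom assms unfolding injective_hom_def by auto
  then have "rev_of G (g e) = g e"
    unfolding M matchings_graph_def by (auto split: prod.splits)
  then have "g (rev_of T e) = g e" using hom assms unfolding injective_hom_def by auto
  then show ?thesis using hom rev assms unfolding injective_hom_def by (meson inj_onD)
qed

section \<open>The extremal dipoles\<close>

text \<open>Arcs \<open>2 * m\<close> and \<open>2 * m + 1\<close> are the two directions of one
  edge, labelled \<open>sigma (m + 1)\<close> because matchings are numbered from 1.\<close>

definition dipole :: "nat \<Rightarrow> (nat, nat, edge_label) labelled_graph" where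
  "dipole k = \<lparr>
     digraph_of = \<lparr>
       verts = {0, 1},
       arcs = {..<2 * k},
       tail = (\<lambda>e. e mod 2),
       head = (\<lambda>e. 1 - e mod 2)\<rparr>,
     rev_of = (\<lambda>e. if even e then e + 1 else e - 1),
     label_of = (\<lambda>e. sigma (e div 2 + 1))\<rparr>"

lemma is_labelled_graph_dipole: "is_labelled_graph (dipole k)"
  unfolding is_labelled_graph_def fin_digraph_def fin_digraph_axioms_def wf_digraph_def
proof (intro conjI ballI)
  fix e assume "e \<in> arcs (digraph_of (dipole k))"
  then have e: "e < 2 * k" by (simp add: dipole_def)
  consider m where "e = 2 * m" | m where "e = 2 * m + 1"
    by (cases "even e") (auto elim: evenE oddE)
  then show "rev_of (dipole k) e \<in> arcs (digraph_of (dipole k))"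
    and "rev_of (dipole k) (rev_of (dipole k) e) = e"
    and "tail (digraph_of (dipole k)) (rev_of (dipole k) e) = head (digraph_of (dipole k)) e"
    and "label_of (dipole k) (rev_of (dipole k) e) = label_of (dipole k) e"
    using e by (cases; simp add: dipole_def; fail)+
qed (auto simp: dipole_def)

lemma connected_dipole:
  assumes "k \<ge> 1"
  shows "Digraph_Component.connected (digraph_of (dipole k))"
proof -
  let ?R = "parcs (mk_symmetric (digraph_of (dipole k)))"
  have "0 \<in> arcs (digraph_of (dipole k))" using assms by (simp add: dipole_def)
  then have "(0, 1) \<in> ?R" "(1, 0) \<in> ?R"
    unfolding parcs_mk_symmetric by (auto intro!: bexI[of _ 0] simp: dipole_def)
  then have "(u, v) \<in> rtrancl_on {0, 1} ?R" if "u \<in> {0, 1}" "v \<in> {0, 1}" for u v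
    using that by (auto intro: rtrancl_on.intros converse_rtrancl_on_into_rtrancl_on)
  then show ?thesis
    unfolding Digraph_Component.connected_def strongly_connected_def reachable_def
    by (simp add: dipole_def)
qed

lemma near_perfect_matching_3: "{{1, 2}} \<in> near_perfect_matchings 3"
proof -
  have "{1..3} - \<Union>{{1, 2}} = {3 :: nat}" by auto
  then show ?thesis unfolding near_perfect_matchings_def by (auto simp: disjoint_def)
qed

lemma finite_near_perfect_matchings: "finite (near_perfect_matchings n)"
  by (rule finite_subset[of _ "Pow (Pow {1..n})"]) (auto simp: near_perfect_matchings_def)

text \<open>On three vertices let all \<open>d\<close> matchings pair 1 with 2. This gives
  \<open>d\<close> parallel edges with distinct labels, of which the dipole uses the first
  \<open>k\<close>.\<close>

lemma is_tangle_dipole: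
  assumes "1 \<le> k" "k \<le> d"
  shows "is_tangle d (dipole k)"
proof -
  \<comment> \<open>Outside \<open>{1..d}\<close> the value must be the default of
    \<open>Pi_pmf\<close> for \<open>M\<close> to lie in the support.\<close>
  define M :: "nat \<Rightarrow> nat set set" where "M j = (if j \<in> {1..d} then {{1, 2}} else {})" for j
  have "M \<in> set_pmf (Pi_pmf {1..d} {} (\<lambda>_. pmf_of_set (near_perfect_matchings 3)))"
  proof -
    have "set_pmf (pmf_of_set (near_perfect_matchings 3)) = near_perfect_matchings 3"
      using near_perfect_matching_3 finite_near_perfect_matchings
      by (intro set_pmf_of_set) blast+
    then show ?thesis
      using near_perfect_matching_3 by (simp add: set_Pi_pmf PiE_dflt_def M_def)
  qed
  then have G: "matchings_graph 3 d M \<in> set_pmf (J_model 3 d)"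
    unfolding J_model_def by simp
  define g :: "nat \<Rightarrow> nat \<times> nat \<times> nat" where "g e = (e div 2 + 1, e mod 2 + 1, 2 - e mod 2)" for e
  have "injective_hom (dipole k) (matchings_graph 3 d M) Suc g"
    unfolding injective_hom_def
  proof (intro conjI ballI)
    show "inj_on g (arcs (digraph_of (dipole k)))"
    proof (rule inj_onI)
      fix a b assume "g a = g b"
      then have "a div 2 = b div 2" "a mod 2 = b mod 2" by (auto simp: g_def)
      then show "a = b" by (metis div_mult_mod_eq)
    qed
  next
    show "g ` arcs (digraph_of (dipole k)) \<subseteq> arcs (digraph_of (matchings_graph 3 d M))"
    proof (rule image_subsetI)
      fix e assume "e \<in> arcs (digraph_of (dipole k))"
      then have "e div 2 + 1 \<in> {1..d}" using assms by (auto simp: dipole_def)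
      moreover have "{e mod 2 + 1, 2 - e mod 2} = {1, 2}" by (cases "even e") auto
      ultimately show "g e \<in> arcs (digraph_of (matchings_graph 3 d M))"
        by (simp add: g_def matchings_graph_def M_def)
    qed
  next
    fix e :: nat
    consider m where "e = 2 * m" | m where "e = 2 * m + 1"
      by (cases "even e") (auto elim: evenE oddE)
    then show "tail (digraph_of (matchings_graph 3 d M)) (g e) = Suc (tail (digraph_of (dipole k)) e)"
      and "head (digraph_of (matchings_graph 3 d M)) (g e) = Suc (head (digraph_of (dipole k)) e)"
      and "rev_of (matchings_graph 3 d M) (g e) = g (rev_of (dipole k) e)"
      and "label_of (matchings_graph 3 d M) (g e) = label_of (dipole k) e"
      by (cases; simp add: dipole_def matchings_graph_def g_def; fail)+
  qed (auto simp: dipole_def matchings_graph_def)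
  then show ?thesis
    using G is_labelled_graph_dipole connected_dipole[OF assms(1)] odd_numeral
    unfolding is_tangle_def by blast
qed

lemma card_parity_class:
  fixes k r :: nat
  assumes "r < 2"
  shows "card {f. f < 2 * k \<and> f mod 2 = r} = k"
proof -
  have "{f. f < 2 * k \<and> f mod 2 = r} = (\<lambda>m. 2 * m + r) ` {..<k}"
  proof (intro equalityI subsetI)
    fix f assume "f \<in> {f. f < 2 * k \<and> f mod 2 = r}"
    then have "f div 2 < k" "f = 2 * (f div 2) + r" by auto
    then show "f \<in> (\<lambda>m. 2 * m + r) ` {..<k}" by blast
  qed (use assms in auto)
  moreover have "inj_on (\<lambda>m. 2 * m + r) {..<k}" by (rule inj_onI) simp
  ultimately show ?thesis by (simp add: card_image)
qed

text \<open>Every arc has exactly \<open>k - 1\<close> non-backtracking successors, so the constant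
  function 1 is an eigenfunction.\<close>

lemma lambda_irr_dipole:
  assumes "k \<ge> 1"
  shows "lambda_irr (dipole k) \<ge> real k - 1"
proof -
  let ?D = "digraph_of (dipole k)"
  have arcs: "arcs ?D = {..<2 * k}" by (simp add: dipole_def)
  then have fin: "finite (arcs ?D)" and ne: "arcs ?D \<noteq> {}" using assms by (auto simp: lessThan_empty_iff)
  have "card {f \<in> arcs ?D. tail ?D f = head ?D e \<and> f \<noteq> rev_of (dipole k) e} = k - 1"
    if e: "e \<in> arcs ?D" for e
  proof -
    let ?F = "{f \<in> arcs ?D. tail ?D f = head ?D e}"
    have "?F = {f. f < 2 * k \<and> f mod 2 = 1 - e mod 2}"
      by (auto simp: dipole_def)
    then have "card ?F = k" using card_parity_class[of "1 - e mod 2" k] by simp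
    moreover have "rev_of (dipole k) e \<in> ?F"
      using is_labelled_graph_dipole e unfolding is_labelled_graph_def by auto
    moreover have "{f \<in> arcs ?D. tail ?D f = head ?D e \<and> f \<noteq> rev_of (dipole k) e}
      = ?F - {rev_of (dipole k) e}" by auto
    ultimately show ?thesis by (simp only: card_Diff_singleton)
  qed
  then have "eigenvalue (adjacency_matrix (T_irr (dipole k))) (of_nat (k - 1))"
    unfolding eigenvalue_T_irr_iff[OF fin] using ne by (intro exI[of _ "\<lambda>_. 1"]) auto
  then have "cmod (of_nat (k - 1)) \<le> lambda_irr (dipole k)"
    using lambda_irr_eigenvalue[OF fin ne] by metis
  then have "real (k - 1) \<le> lambda_irr (dipole k)" by (simp only: norm_of_nat)
  then show ?thesis using assms by (simp add: of_nat_diff)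
qed

lemma graph_order_dipole: "graph_order (dipole k) = int k - 2"
proof -
  have "undirected_edges (dipole k) = (\<lambda>m. {2 * m, 2 * m + 1}) ` {..<k}"
  proof (intro equalityI subsetI)
    fix p assume "p \<in> undirected_edges (dipole k)"
    then obtain e where e: "e < 2 * k" and p: "p = {e, rev_of (dipole k) e}"
      by (auto simp: undirected_edges_def dipole_def)
    have "p = {2 * (e div 2), 2 * (e div 2) + 1}"
      unfolding p dipole_def by (cases "even e") (auto elim!: evenE oddE)
    moreover have "e div 2 < k" using e by simp
    ultimately show "p \<in> (\<lambda>m. {2 * m, 2 * m + 1}) ` {..<k}" by blast
  next
    fix p assume "p \<in> (\<lambda>m. {2 * m, 2 * m + 1}) ` {..<k}"
    then obtain m where "m < k" "p = {2 * m, 2 * m + 1}" by blast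
    then show "p \<in> undirected_edges (dipole k)"
      unfolding undirected_edges_def by (intro image_eqI[of _ _ "2 * m"]) (auto simp: dipole_def)
  qed
  moreover have "inj_on (\<lambda>m::nat. {2 * m, 2 * m + 1}) {..<k}"
    by (rule inj_onI) (auto simp: doubleton_eq_iff)
  ultimately have "card (undirected_edges (dipole k)) = k" by (simp add: card_image)
  moreover have "card (verts (digraph_of (dipole k))) = 2" by (simp add: dipole_def)
  ultimately show ?thesis unfolding graph_order_def by simp
qed

text \<open>Ensures that \<open>d\<close> matchings supply enough parallel edges for the extremal
  dipole.\<close>

lemma ceiling_sqrt_less:
  fixes d :: nat
  assumes "d \<ge> 3"
  shows "\<lceil>sqrt (real d - 1)\<rceil> + 1 \<le> int d"
proof -
  have "real d - 1 \<le> (real d - 1)\<^sup>2"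
    using assms by (simp add: power2_eq_square)
  then have "sqrt (real d - 1) \<le> real d - 1"
    using assms by (intro real_le_lsqrt) auto
  then have "\<lceil>sqrt (real d - 1)\<rceil> \<le> int d - 1" by (intro ceiling_le) simp
  then show ?thesis by simp
qed

section \<open>The smallest supercritical order\<close>

theorem theorem6p12:
  fixes d :: nat
  assumes "d \<ge> 3"
  shows "\<lceil>sqrt (real d - 1)\<rceil> - 1 \<in> supercritical_orders d \<and>
         (\<forall>k \<in> supercritical_orders d. \<lceil>sqrt (real d - 1)\<rceil> - 1 \<le> k)"
proof
  have pos: "sqrt (real d - 1) > 0" using assms by simp
  \<comment> \<open>The least number of parallel edges with
    \<open>k - 1 \<ge> sqrt (real d - 1)\<close>; the dipole then has order
    \<open>k - 2\<close>.\<close>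
  define k where "k = nat (\<lceil>sqrt (real d - 1)\<rceil> + 1)"
  have "\<lceil>sqrt (real d - 1)\<rceil> > 0" using pos by (simp only: zero_less_ceiling)
  then have k: "int k = \<lceil>sqrt (real d - 1)\<rceil> + 1" unfolding k_def by linarith
  then have "1 \<le> k" "k \<le> d"
    using \<open>\<lceil>sqrt (real d - 1)\<rceil> > 0\<close> ceiling_sqrt_less[OF assms] by linarith+
  have "real k - 1 = real_of_int \<lceil>sqrt (real d - 1)\<rceil>"
    using arg_cong[OF k, of real_of_int] by simp
  then have "sqrt (real d - 1) \<le> lambda_irr (dipole k)"
    using lambda_irr_dipole[OF \<open>1 \<le> k\<close>] le_of_int_ceiling[of "sqrt (real d - 1)"] by linarith
  then have "supercritical_tangle d (dipole k)"
    using is_tangle_dipole[OF \<open>1 \<le> k\<close> \<open>k \<le> d\<close>] unfolding supercritical_tangle_def by blast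
  moreover have "graph_order (dipole k) = \<lceil>sqrt (real d - 1)\<rceil> - 1"
    using graph_order_dipole k by simp
  ultimately show "\<lceil>sqrt (real d - 1)\<rceil> - 1 \<in> supercritical_orders d"
    unfolding supercritical_orders_def by force
  show "\<forall>k \<in> supercritical_orders d. \<lceil>sqrt (real d - 1)\<rceil> - 1 \<le> k"
  proof
    fix k assume "k \<in> supercritical_orders d"
    then obtain T :: "(nat, nat, edge_label) labelled_graph"
      where T: "supercritical_tangle d T" and k: "k = graph_order T"
      unfolding supercritical_orders_def by blast
    have tangle: "is_tangle d T" and super: "sqrt (real d - 1) \<le> lambda_irr T"
      using T unfolding supercritical_tangle_def by auto
    have "is_labelled_graph T" "Digraph_Component.connected (digraph_of T)"
      using tangle unfolding is_tangle_def by blast+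
    moreover have "lambda_irr T > 0" using pos super by (rule less_le_trans)
    ultimately have "lambda_irr T \<le> real_of_int (graph_order T) + 1"
      using tangle_no_whole_loop[OF tangle] by (intro lambda_irr_le_order)
    then have "sqrt (real d - 1) \<le> real_of_int (k + 1)" using super k by simp
    \<comment> \<open>As \<open>k + 1\<close> is an integer, the bound passes from the square root
      to its ceiling.\<close>
    then show "\<lceil>sqrt (real d - 1)\<rceil> - 1 \<le> k" using ceiling_le by fastforce
  qed
qed

end
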